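(* Let $\mathcal V$ and $\mathcal W$ be two $m$-dimensional subspaces of a Hilbert space $\mathcal H$, with $m\ge 1$ and $d=\dim\mathcal H$. Let $P_{\mathcal V}$ and $P_{\mathcal W}$ denote the orthogonal projections of $\mathcal H$ onto $\mathcal V$ and $\mathcal W$ respectively. Let $Q_{\mathcal V}$ and $Q_{\mathcal W}$ be $d\times m$ matrices whose column vectors are the elements of orthonormal bases of $\mathcal V$ and $\mathcal W$ respectively, represented in any orthonormal basis for $\mathcal H$. Then the following conditions are equivalent: (i) $\mathcal V$ and $\mathcal W$ are isoclinic subspaces. (ii) $Q_{\mathcal V}^*Q_{\mathcal W}$ is a scalar multiple of a unitary on $\mathbb C^m$. (iii) There exists $\lambda\ge 0$ such that $$P_{\mathcal V}P_{\mathcal W}P_{\mathcal V}=\lambda P_{\mathcal V}\quad\text{and}\quad P_{\mathcal W}P_{\mathcal V}P_{\mathcal W}=\lambda P_{\mathcal W}.$$ Here, $\lambda=\cos(\theta)$ where $\mathcal V$, $\mathcal W$ are isoclinic at angle $\theta$. (iv) The angle between any non-zero vector in $\mathcal V$ and its projection on $\mathcal W$ is constant; in other words, $\|P_{\mathcal W}x\|\,\|x\|^{-1}$ is constant for $0\ne x\in\mathcal V$. And the same holds true with the roles of $\mathcal V$, $\mathcal W$ reversed.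
   Context: Canonical angles. Let $\mathcal V,\mathcal W$ be finite-dimensional subspaces of a Hilbert space $\mathcal H$ and $l=\min\{\dim\mathcal V,\dim\mathcal W\}$. The canonical angles $\theta_1,\dots,\theta_l\in[0,\frac{\pi}{2}]$ between $\mathcal V$ and $\mathcal W$ are defined recursively: for $k=1,\dots,l$, $\theta_k$ is the unique number in $[0,\frac{\pi}{2}]$ with $$\cos(\theta_k)=\max\{|\langle x,y\rangle| : x\in\mathcal V\cap\{x_1,\dots,x_{k-1}\}^\perp,\ y\in\mathcal W\cap\{y_1,\dots,y_{k-1}\}^\perp,\ \|x\|=\|y\|=1\},$$ where $x_j\in\mathcal V$, $y_j\in\mathcal W$ ($j<k$) are unit vectors chosen so that the $j$-th maximum is attained at $(x_j,y_j)$ (for $k=1$ there are no orthogonality constraints). Isoclinic subspaces. Two $m$-dimensional subspaces $\mathcal V,\mathcal W$ of $\mathcal H$ ($1\le m\le\dim\mathcal H$) are isoclinic if all $m$ canonical angles between them are equal; if that angle is $\theta$, they are isoclinic at angle $\theta$.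
   Formalization: In (iii), "λ = cos(θ)" is corrected to λ = cos²(θ): as written it fails, e.g. for two lines in ℂ² at angle π/3, where P_V P_W P_V = (1/4) P_V but cos(θ) = 1/2. *)

theory Defs
  imports "HOL-Analysis.Analysis"
begin

text \<open>Complex Hilbert spaces of arbitrary (finite or infinite) dimension. Completeness and the
  metric structure come from \<^class>\<open>banach\<close>; the inner product is conjugate-linear in its
  first argument.\<close>

class complex_hilbert = banach +
  fixes scaleC :: "complex \<Rightarrow> 'a \<Rightarrow> 'a" (infixr "*\<^sub>C" 75)
    and cinner :: "'a \<Rightarrow> 'a \<Rightarrow> complex"
  assumes scaleC_add_right: "a *\<^sub>C (x + y) = a *\<^sub>C x + a *\<^sub>C y"
    and scaleC_add_left: "(a + b) *\<^sub>C x = a *\<^sub>C x + b *\<^sub>C x"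
    and scaleC_scaleC: "a *\<^sub>C (b *\<^sub>C x) = (a * b) *\<^sub>C x"
    and scaleC_one: "1 *\<^sub>C x = x"
    and scaleR_scaleC: "r *\<^sub>R x = complex_of_real r *\<^sub>C x"
    and cinner_commute: "cinner x y = cnj (cinner y x)"
    and cinner_add_right: "cinner x (y + z) = cinner x y + cinner x z"
    and cinner_scaleC_right: "cinner x (a *\<^sub>C y) = a * cinner x y"
    and cinner_ge_zero: "0 \<le> Re (cinner x x)"
    and cinner_eq_zero_iff: "cinner x x = 0 \<longleftrightarrow> x = 0"
    and norm_eq_sqrt_cinner: "norm x = sqrt (Re (cinner x x))"

global_interpretation complex_vector: vector_space "scaleC :: complex \<Rightarrow> 'a \<Rightarrow> 'a :: complex_hilbert"
  defines cdependent = complex_vector.dependent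
    and crepresentation = complex_vector.representation
    and csubspace = complex_vector.subspace
    and cspan = complex_vector.span
    and cextend_basis = complex_vector.extend_basis
    and cdim = complex_vector.dim
  by unfold_locales (simp_all add: scaleC_add_right scaleC_add_left scaleC_scaleC scaleC_one)

text \<open>As for every \<^locale>\<open>vector_space\<close> in the library, \<^const>\<open>cdim\<close> is \<open>0\<close> on subspaces of
  infinite dimension, so \<open>cdim V = m\<close> with \<open>m \<ge> 1\<close> entails that \<open>V\<close> has finite dimension \<open>m\<close>.\<close>

definition orthonormal_on :: "'i set \<Rightarrow> ('i \<Rightarrow> 'a::complex_hilbert) \<Rightarrow> bool" where
  "orthonormal_on I e \<longleftrightarrow> (\<forall>i\<in>I. \<forall>j\<in>I. cinner (e i) (e j) = (if i = j then 1 else 0))"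

text \<open>Orthonormal basis of the whole space in the Hilbert space sense (dense linear span); for a
  finite family the closure is redundant.\<close>

definition hilbert_basis :: "'i set \<Rightarrow> ('i \<Rightarrow> 'a::complex_hilbert) \<Rightarrow> bool" where
  "hilbert_basis I e \<longleftrightarrow> orthonormal_on I e \<and> closure (cspan (e ` I)) = UNIV"

definition orthonormal_basis_of :: "('m::finite \<Rightarrow> 'a::complex_hilbert) \<Rightarrow> 'a set \<Rightarrow> bool" where
  "orthonormal_basis_of v V \<longleftrightarrow> orthonormal_on UNIV v \<and> cspan (range v) = V"

definition orth_proj :: "'a::complex_hilbert set \<Rightarrow> 'a \<Rightarrow> 'a" where
  "orth_proj V x = (THE y. y \<in> V \<and> (\<forall>v\<in>V. cinner v (x - y) = 0))"

text \<open>The pairs of unit vectors over which the \<open>k\<close>-th maximum is taken (counting from \<open>0\<close>), given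
  the previously chosen \<open>x\<^sub>0, \<dots>, x\<^bsub>k-1\<^esub>\<close> and \<open>y\<^sub>0, \<dots>, y\<^bsub>k-1\<^esub>\<close>.\<close>

definition admissible_pairs ::
  "'a::complex_hilbert set \<Rightarrow> 'a set \<Rightarrow> (nat \<Rightarrow> 'a) \<Rightarrow> (nat \<Rightarrow> 'a) \<Rightarrow> nat \<Rightarrow> ('a \<times> 'a) set" where
  "admissible_pairs V W x y k =
     {(u, w). u \<in> V \<and> w \<in> W \<and> norm u = 1 \<and> norm w = 1 \<and>
              (\<forall>j<k. cinner (x j) u = 0) \<and> (\<forall>j<k. cinner (y j) w = 0)}"

text \<open>\<open>canonical_angles V W \<theta>\<close> says that \<open>\<theta> 0, \<dots>, \<theta> (l - 1)\<close>, where \<open>l = min (cdim V) (cdim W)\<close>, are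
  the angles produced by the recursion for some choice of the maximising pairs \<open>(x k, y k)\<close>. The
  angles do not depend on that choice. Values of \<open>\<theta>\<close> at arguments \<open>\<ge> l\<close> are irrelevant.\<close>

definition canonical_angles ::
  "'a::complex_hilbert set \<Rightarrow> 'a set \<Rightarrow> (nat \<Rightarrow> real) \<Rightarrow> bool" where
  "canonical_angles V W \<theta> \<longleftrightarrow>
     (\<exists>x y. \<forall>k < min (cdim V) (cdim W).
        0 \<le> \<theta> k \<and> \<theta> k \<le> pi / 2 \<and>
        (x k, y k) \<in> admissible_pairs V W x y k \<and>
        cmod (cinner (x k) (y k)) = cos (\<theta> k) \<and>
        (\<forall>(u, w) \<in> admissible_pairs V W x y k. cmod (cinner u w) \<le> cos (\<theta> k)))"

definition isoclinic_at :: "'a::complex_hilbert set \<Rightarrow> 'a set \<Rightarrow> real \<Rightarrow> bool" where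
  "isoclinic_at V W t \<longleftrightarrow>
     (\<exists>\<theta>. canonical_angles V W \<theta> \<and> (\<forall>k < min (cdim V) (cdim W). \<theta> k = t))"

definition isoclinic :: "'a::complex_hilbert set \<Rightarrow> 'a set \<Rightarrow> bool" where
  "isoclinic V W \<longleftrightarrow> (\<exists>t. isoclinic_at V W t)"

text \<open>The matrix whose columns are the coordinate vectors of the \<open>v i\<close> in the basis \<open>e\<close>. Its rows are
  indexed by the basis of the ambient space, which may be infinite, so it is kept as a function.\<close>

definition coord_matrix ::
  "('i \<Rightarrow> 'a::complex_hilbert) \<Rightarrow> ('m \<Rightarrow> 'a) \<Rightarrow> 'i \<Rightarrow> 'm \<Rightarrow> complex" where
  "coord_matrix e v = (\<lambda>k i. cinner (e k) (v i))"

text \<open>The product \<open>Q\<^sup>* R\<close> of matrices with rows indexed by \<open>I\<close>; for finite \<open>I\<close> this is the ordinary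
  finite sum.\<close>

definition adjoint_times ::
  "'i set \<Rightarrow> ('i \<Rightarrow> 'm::finite \<Rightarrow> complex) \<Rightarrow> ('i \<Rightarrow> 'm \<Rightarrow> complex) \<Rightarrow> complex ^ 'm ^ 'm" where
  "adjoint_times I Q R = (\<chi> i j. \<Sum>\<^sub>\<infinity>k\<in>I. cnj (Q k i) * R k j)"

definition conj_transpose :: "complex ^ 'm ^ 'm \<Rightarrow> complex ^ 'm ^ 'm" where
  "conj_transpose A = (\<chi> i j. cnj (A $ j $ i))"

definition unitary_matrix :: "complex ^ 'm ^ 'm \<Rightarrow> bool" where
  "unitary_matrix U \<longleftrightarrow> conj_transpose U ** U = mat 1 \<and> U ** conj_transpose U = mat 1"

end

theory Submission
  imports Defs
begin

text \<open>
  Everything reduces to one number: the ratio \<open>c\<close> with \<open>\<parallel>P\<^sub>W x\<parallel> = c \<parallel>x\<parallel>\<close> for all \<open>x \<in> V\<close>, if there is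
  one (\<open>projects_with_ratio\<close>). Polarization turns this into
  \<open>\<langle>P\<^sub>W x, P\<^sub>W y\<rangle> = c\<^sup>2 \<langle>x, y\<rangle>\<close> on \<open>V\<close>, so that a ratio exists exactly when \<open>P\<^sub>W\<close> restricted to \<open>V\<close>
  is a multiple of an isometry, and this can be tested on one orthonormal basis
  (\<open>projects_with_ratio_of_orthogonal_images\<close>). Each of the four conditions expresses it:

  \<^item> For \<open>x, y \<in> V\<close> we have \<open>\<langle>P\<^sub>W x, P\<^sub>W y\<rangle> = \<langle>x, P\<^sub>V P\<^sub>W y\<rangle>\<close>, so \<open>P\<^sub>V P\<^sub>W P\<^sub>V = \<mu> P\<^sub>V\<close> says
    that the ratio is \<open>sqrt \<mu>\<close> (\<open>proj_triple_eq_iff_ratio\<close>).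

  \<^item> By Parseval's identity the matrix \<open>Q\<^sub>V\<^sup>* Q\<^sub>W\<close> is \<open>M\<close> with entries \<open>\<langle>v\<^sub>i, w\<^sub>j\<rangle>\<close>, whatever the basis
    of the ambient space. The Gram matrix of the vectors \<open>P\<^sub>W v\<^sub>i\<close> is \<open>M M\<^sup>*\<close>, and for a square
    matrix \<open>M M\<^sup>* = c\<^sup>2 1\<close> means that \<open>M\<close> is a multiple of a unitary
    (\<open>cross_gram_scaled_unitary_iff_ratio\<close>).

  \<^item> If all canonical angles equal \<open>t\<close>, the first maximum gives \<open>\<parallel>P\<^sub>W u\<parallel> \<le> cos t\<close> for unit vectors
    \<open>u \<in> V\<close>, while the component of \<open>P\<^sub>W x\<^sub>k\<close> along \<open>y\<^sub>k\<close> already has length \<open>cos t\<close>. Hence \<open>P\<^sub>W x\<^sub>k\<close> is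
    a multiple of \<open>y\<^sub>k\<close>: the maximising pairs are orthonormal bases matched by \<open>P\<^sub>W\<close>, and the
    ratio is \<open>cos t\<close> (\<open>isoclinic_at_imp_ratio\<close>). Conversely, with ratio \<open>c\<close>, any orthonormal
    basis of \<open>V\<close> together with its normalised image (or, if \<open>c = 0\<close>, any orthonormal basis of \<open>W\<close>)
    solves the recursion with all angles \<open>arccos c\<close> (\<open>ratio_imp_isoclinic_at\<close>).

  Canonical angles are symmetric in \<open>V\<close> and \<open>W\<close>, so a ratio for \<open>V\<close> onto \<open>W\<close> forces the same ratio
  for \<open>W\<close> onto \<open>V\<close>. This supplies the reversed halves of the conditions on projections with the same
  constant.
\<close>

section \<open>Elementary inner product calculus\<close>

lemma cnj_cinner [simp]: "cnj (cinner x y) = cinner y x"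
  by (rule cinner_commute[symmetric])

lemma cinner_zero_right [simp]: "cinner x 0 = 0"
  using cinner_add_right[of x 0 0] by simp

lemma cinner_zero_left [simp]: "cinner 0 x = 0"
  using cinner_commute[of 0 x] by simp

lemma cinner_add_left: "cinner (x + y) z = cinner x z + cinner y z"
  by (subst (1 2 3) cinner_commute) (simp add: cinner_add_right)

lemma cinner_scaleC_left: "cinner (a *\<^sub>C x) y = cnj a * cinner x y"
  by (subst (1 2) cinner_commute) (simp add: cinner_scaleC_right)

lemma cinner_diff_right: "cinner x (y - z) = cinner x y - cinner x z"
  by (metis add_diff_cancel_right' cinner_add_right diff_add_cancel)

lemma cinner_sum_right: "cinner x (\<Sum>i\<in>A. f i) = (\<Sum>i\<in>A. cinner x (f i))"
  by (induction A rule: infinite_finite_induct) (simp_all add: cinner_add_right)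

lemma cinner_sum_left: "cinner (\<Sum>i\<in>A. f i) x = (\<Sum>i\<in>A. cinner (f i) x)"
  by (induction A rule: infinite_finite_induct) (simp_all add: cinner_add_left)

lemma cinner_same: "cinner x x = complex_of_real ((norm x)\<^sup>2)"
proof -
  have "cinner x x \<in> \<real>"
    using cinner_commute[of x x] by (simp add: Reals_cnj_iff)
  then show ?thesis
    by (simp add: norm_eq_sqrt_cinner cinner_ge_zero)
qed

lemma norm_scaleC: "norm (a *\<^sub>C x) = cmod a * norm x"
proof -
  have "complex_of_real ((norm (a *\<^sub>C x))\<^sup>2) = (cnj a * a) * cinner x x"
    unfolding cinner_same[symmetric] by (simp add: cinner_scaleC_left cinner_scaleC_right)
  also have "\<dots> = complex_of_real ((cmod a * norm x)\<^sup>2)"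
    by (simp add: cinner_same complex_norm_square[symmetric] power_mult_distrib mult.commute)
  finally have "(norm (a *\<^sub>C x))\<^sup>2 = (cmod a * norm x)\<^sup>2"
    using of_real_eq_iff by blast
  then show ?thesis
    by (simp add: power2_eq_iff_nonneg)
qed

lemma norm_add_square:
  "(norm (x + y))\<^sup>2 = (norm x)\<^sup>2 + (norm y)\<^sup>2 + 2 * Re (cinner x y)"
proof -
  have "(norm z)\<^sup>2 = Re (cinner z z)" for z :: 'a
    by (simp add: cinner_same)
  moreover have "Re (cinner y x) = Re (cinner x y)"
    by (metis cnj_cinner cnj.sel(1))
  ultimately show ?thesis
    by (simp add: cinner_add_left cinner_add_right)
qed

lemma norm_le_norm_add_of_orthogonal:
  assumes "cinner x y = 0"
  shows "norm x \<le> norm (x + y)"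
  using norm_add_square[of x y] assms by (simp add: power2_le_imp_le)

lemma Cauchy_Schwarz: "cmod (cinner x y) \<le> norm x * norm y"
proof (cases "x = 0")
  case False
  \<comment> \<open>\<open>a x\<close> is the component of \<open>y\<close> along \<open>x\<close>.\<close>
  define a where "a = cinner x y / complex_of_real ((norm x)\<^sup>2)"
  have *: "cinner (a *\<^sub>C x) (y - a *\<^sub>C x) = 0"
    using False
    by (simp add: a_def cinner_diff_right cinner_scaleC_left cinner_scaleC_right cinner_same[of x])
  have "norm (a *\<^sub>C x) \<le> norm y"
    using norm_le_norm_add_of_orthogonal[OF *] by simp
  then have "cmod (cinner x y) / (norm x)\<^sup>2 * norm x \<le> norm y"
    unfolding norm_scaleC a_def norm_divide norm_of_real by simp
  then show ?thesis
    using False by (simp add: field_simps power2_eq_square)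
qed simp

text \<open>Polarization: the squared norms of \<open>x + y\<close> and \<open>x + \<i> y\<close> recover the real and
  imaginary parts of the inner product.\<close>

lemma cinner_of_scaled_norm:
  assumes add: "\<And>x y. T (x + y) = T x + T y" and scale: "\<And>a x. T (a *\<^sub>C x) = a *\<^sub>C T x"
    and V: "csubspace V" and T: "\<And>x. x \<in> V \<Longrightarrow> norm (T x) = c * norm x"
    and xy: "x \<in> V" "y \<in> V"
  shows "cinner (T x) (T y) = complex_of_real (c\<^sup>2) * cinner x y"
proof -
  have Re: "Re (cinner (T x) (T y)) = c\<^sup>2 * Re (cinner x y)" if "x \<in> V" "y \<in> V" for x y
  proof -
    have "x + y \<in> V"
      using V that by (rule complex_vector.subspace_add)
    then have "(norm (T x + T y))\<^sup>2 = c\<^sup>2 * (norm (x + y))\<^sup>2"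
      using T by (simp add: add[symmetric] power_mult_distrib)
    then show ?thesis
      using T[OF that(1)] T[OF that(2)]
      by (simp add: norm_add_square power_mult_distrib algebra_simps)
  qed
  have "\<i> *\<^sub>C y \<in> V"
    using V xy(2) by (rule complex_vector.subspace_scale)
  from Re[OF xy(1) this] have "Im (cinner (T x) (T y)) = c\<^sup>2 * Im (cinner x y)"
    by (simp add: scale cinner_scaleC_right)
  with Re[OF xy] show ?thesis
    by (simp add: complex_eq_iff)
qed

section \<open>Orthonormal families\<close>

lemma orthonormal_onD:
  "orthonormal_on S e \<Longrightarrow> i \<in> S \<Longrightarrow> j \<in> S \<Longrightarrow> cinner (e i) (e j) = (if i = j then 1 else 0)"
  by (simp add: orthonormal_on_def)

lemma cinner_orthonormal_combination:
  assumes "finite S" "orthonormal_on S e" "i \<in> S"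
  shows "cinner (e i) (\<Sum>k\<in>S. a k *\<^sub>C e k) = a i"
proof -
  have "cinner (e i) (\<Sum>k\<in>S. a k *\<^sub>C e k) = (\<Sum>k\<in>S. if i = k then a k else 0)"
    using assms(3)
    by (simp add: cinner_sum_right cinner_scaleC_right orthonormal_onD[OF assms(2)] cong: sum.cong)
      (auto intro: sum.cong)
  then show ?thesis
    using assms by simp
qed

lemma norm_orthonormal_combination:
  assumes "finite S" "orthonormal_on S e"
  shows "(norm (\<Sum>k\<in>S. a k *\<^sub>C e k))\<^sup>2 = (\<Sum>k\<in>S. (cmod (a k))\<^sup>2)"
proof -
  have "complex_of_real ((norm (\<Sum>k\<in>S. a k *\<^sub>C e k))\<^sup>2) = (\<Sum>i\<in>S. cnj (a i) * a i)"
    unfolding cinner_same[symmetric]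
    by (subst cinner_sum_left)
      (simp add: cinner_scaleC_left cinner_orthonormal_combination[OF assms])
  also have "\<dots> = complex_of_real (\<Sum>k\<in>S. (cmod (a k))\<^sup>2)"
    unfolding of_real_sum complex_norm_square by (simp add: mult.commute)
  finally show ?thesis
    using of_real_eq_iff by blast
qed

lemma orthonormal_expansion:
  assumes "finite S" "orthonormal_on S e" "x \<in> cspan (e ` S)"
  shows "x = (\<Sum>k\<in>S. cinner (e k) x *\<^sub>C e k)"
  using assms(3)
proof (induction rule: complex_vector.span_induct_alt)
  case base
  then show ?case
    by (simp add: complex_vector.scale_zero_left)
next
  case (step c x y)
  then obtain i where i: "i \<in> S" "x = e i"
    by auto
  have "(\<Sum>k\<in>S. cinner (e k) (e i) *\<^sub>C e k) = (\<Sum>k\<in>S. if i = k then e k else 0)"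
    using i assms(2)
    by (auto simp: orthonormal_on_def complex_vector.scale_one intro!: sum.cong)
  then have x: "(\<Sum>k\<in>S. cinner (e k) x *\<^sub>C e k) = x"
    using i assms(1) by simp
  have "(\<Sum>k\<in>S. cinner (e k) (c *\<^sub>C x + y) *\<^sub>C e k)
      = c *\<^sub>C (\<Sum>k\<in>S. cinner (e k) x *\<^sub>C e k) + (\<Sum>k\<in>S. cinner (e k) y *\<^sub>C e k)"
    by (simp add: cinner_add_right cinner_scaleC_right scaleC_add_left scaleC_scaleC
        complex_vector.scale_sum_right sum.distrib)
  also have "\<dots> = c *\<^sub>C x + y"
    by (simp only: x step.IH[symmetric])
  finally show ?case
    by (rule sym)
qed

lemma orthonormal_independent:
  assumes "finite S" "orthonormal_on S e"
  shows "\<not> cdependent (e ` S)" and "inj_on e S"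
proof -
  show inj: "inj_on e S"
    using assms(2) unfolding inj_on_def orthonormal_on_def by (metis zero_neq_one)
  have "u y = 0" if zero: "(\<Sum>x\<in>e ` S. u x *\<^sub>C x) = 0" and y: "y \<in> e ` S" for u y
  proof -
    obtain i where i: "i \<in> S" "y = e i"
      using y by blast
    have "(\<Sum>k\<in>S. u (e k) *\<^sub>C e k) = 0"
      using zero inj by (simp add: sum.reindex)
    with cinner_orthonormal_combination[OF assms i(1), of "\<lambda>k. u (e k)"] show ?thesis
      by (simp add: i)
  qed
  then show "\<not> cdependent (e ` S)"
    using assms(1) complex_vector.dependent_finite[of "e ` S"] by blast
qed

text \<open>A vector of \<open>V\<close> outside the span would extend the family to an independent set with more
  than \<open>cdim V\<close> elements. Positivity of the cardinality matters: \<^const>\<open>cdim\<close> is also \<open>0\<close> on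
  infinite-dimensional subspaces, which the empty family does not span.\<close>

lemma orthonormal_spans_of_card:
  assumes "orthonormal_on S e" "e ` S \<subseteq> V" "csubspace V" "cdim V = card S" "0 < card S"
  shows "cspan (e ` S) = V"
proof -
  have S: "finite S"
    using assms(5) card_gt_0_iff by blast
  note ind = orthonormal_independent[OF S assms(1)]
  obtain B where B: "B \<subseteq> V" "\<not> cdependent B" "V \<subseteq> cspan B" "card B = cdim V"
    by (rule complex_vector.basis_exists)
  have fB: "finite B"
    using B(4) assms(4,5) card_gt_0_iff by metis
  have "a \<in> cspan (e ` S)" if "a \<in> V" for a
  proof (rule ccontr)
    assume a: "a \<notin> cspan (e ` S)"
    then have "\<not> cdependent (insert a (e ` S))"
      using ind(1) complex_vector.independent_insertI by blast
    moreover have "insert a (e ` S) \<subseteq> cspan B"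
      using that assms(2) B(3) by blast
    ultimately have "card (insert a (e ` S)) \<le> card B"
      using complex_vector.independent_span_bound[OF fB] by blast
    moreover have "a \<notin> e ` S"
      using a by (meson complex_vector.span_base)
    ultimately show False
      using S B(4) assms(4) by (simp add: card_image[OF ind(2)])
  qed
  moreover have "cspan (e ` S) \<subseteq> V"
    using assms(2,3) by (rule complex_vector.span_minimal)
  ultimately show ?thesis
    by blast
qed

text \<open>The sum over \<open>I\<close> may be uncountable, so it is treated as the limit along finite subsets.
  Once a finite set \<open>F\<close> carries a vector of the span close to \<open>y\<close>, the partial Fourier sum
  of \<open>y\<close> over any larger finite set, being the best approximation, is at least as close; pairing
  the error with \<open>x\<close> bounds the error of the partial sum.\<close>

lemma Parseval_cinner:
  assumes "hilbert_basis I e"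
  shows "((\<lambda>k. cnj (cinner (e k) x) * cinner (e k) y) has_sum cinner x y) I"
proof -
  have on: "orthonormal_on I e" and dense: "closure (cspan (e ` I)) = UNIV"
    using assms by (auto simp: hilbert_basis_def)
  show ?thesis
    unfolding has_sum_def tendsto_iff
  proof (intro allI impI)
    fix \<epsilon> :: real assume "0 < \<epsilon>"
    \<comment> \<open>The summand \<open>1\<close> only keeps the denominator positive when \<open>x = 0\<close>.\<close>
    define \<delta> where "\<delta> = \<epsilon> / (norm x + 1)"
    have xpos: "0 < norm x + 1"
      by (smt (verit) norm_ge_zero)
    then have \<delta>: "0 < \<delta>" "norm x * \<delta> < \<epsilon>"
      using \<open>0 < \<epsilon>\<close> by (simp_all add: \<delta>_def field_simps)
    have "y \<in> closure (cspan (e ` I))"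
      by (simp add: dense)
    then obtain z where z: "z \<in> cspan (e ` I)" "dist z y < \<delta>"
      using \<delta>(1) closure_approachable by blast
    obtain t r where t: "finite t" "t \<subseteq> e ` I" "z = (\<Sum>a\<in>t. r a *\<^sub>C a)"
      using z(1) unfolding complex_vector.span_explicit by blast
    obtain F where F: "F \<subseteq> I" "finite F" "t = e ` F"
      using finite_subset_image[OF t(1,2)] by blast
    have "dist (\<Sum>k\<in>G. cnj (cinner (e k) x) * cinner (e k) y) (cinner x y) < \<epsilon>"
      if G: "finite G" "F \<subseteq> G" "G \<subseteq> I" for G
    proof -
      define p where "p = (\<Sum>k\<in>G. cinner (e k) y *\<^sub>C e k)"
      have onG: "orthonormal_on G e"
        using on G(3) unfolding orthonormal_on_def by (meson subsetD)
      have zG: "z \<in> cspan (e ` G)"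
        unfolding t(3) F(3)
        by (intro complex_vector.span_sum complex_vector.span_scale complex_vector.span_base)
          (use G in auto)
      have coeff: "cinner (e k) (y - p) = 0" if "k \<in> G" for k
        using cinner_orthonormal_combination[OF G(1) onG that]
        by (simp add: p_def cinner_diff_right)
      \<comment> \<open>The error \<open>y - p\<close> is orthogonal to the span of \<open>e ` G\<close>, which contains \<open>p - z\<close>.\<close>
      have "p - z = (\<Sum>k\<in>G. (cinner (e k) y - cinner (e k) z) *\<^sub>C e k)"
        by (subst orthonormal_expansion[OF G(1) onG zG])
          (simp add: p_def complex_vector.scale_left_diff_distrib sum_subtractf)
      then have "cinner (p - z) (y - p) = 0"
        using coeff by (simp add: cinner_sum_left cinner_scaleC_left)
      then have "cinner (y - p) (p - z) = 0"
        by (metis cnj_cinner complex_cnj_zero)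
      from norm_le_norm_add_of_orthogonal[OF this] have "norm (y - p) \<le> norm (y - z)"
        by simp
      then have near: "norm (y - p) < \<delta>"
        using z(2) by (simp add: dist_norm norm_minus_commute)
      have "cinner x p = (\<Sum>k\<in>G. cnj (cinner (e k) x) * cinner (e k) y)"
        unfolding p_def cinner_sum_right cinner_scaleC_right
        by (simp add: mult.commute)
      then have "dist (\<Sum>k\<in>G. cnj (cinner (e k) x) * cinner (e k) y) (cinner x y)
          = cmod (cinner x (y - p))"
        by (simp add: dist_norm cinner_diff_right norm_minus_commute)
      also have "\<dots> \<le> norm x * norm (y - p)"
        by (rule Cauchy_Schwarz)
      also have "\<dots> \<le> norm x * \<delta>"
        using near by (simp add: mult_left_mono)
      finally show ?thesis
        using \<delta>(2) by simp
    qed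
    then show "\<forall>\<^sub>F G in finite_subsets_at_top I.
        dist (\<Sum>k\<in>G. cnj (cinner (e k) x) * cinner (e k) y) (cinner x y) < \<epsilon>"
      unfolding eventually_finite_subsets_at_top using F(1,2) by blast
  qed
qed

text \<open>Parseval's identity removes the ambient basis from the product of the coordinate matrices.\<close>

lemma adjoint_times_coord_matrix:
  assumes "hilbert_basis I e"
  shows "adjoint_times I (coord_matrix e v) (coord_matrix e w) = (\<chi> i j. cinner (v i) (w j))"
  unfolding adjoint_times_def coord_matrix_def
  using infsumI[OF Parseval_cinner[OF assms]] by simp

section \<open>Orthogonal projections onto finite-dimensional subspaces\<close>

lemma orth_proj_eqI:
  assumes W: "csubspace W" and p: "p \<in> W" "\<And>y. y \<in> W \<Longrightarrow> cinner y p = cinner y x"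
  shows "orth_proj W x = p"
  unfolding orth_proj_def
proof (rule the_equality)
  show "p \<in> W \<and> (\<forall>y\<in>W. cinner y (x - p) = 0)"
    using p by (simp add: cinner_diff_right)
next
  fix q assume q: "q \<in> W \<and> (\<forall>y\<in>W. cinner y (x - q) = 0)"
  then have "q - p \<in> W"
    using W p(1) complex_vector.subspace_diff by blast
  then have "cinner (q - p) (q - p) = 0"
    using q p(2) by (simp add: cinner_diff_right)
  then show "q = p"
    by (simp add: cinner_eq_zero_iff)
qed

context
  fixes w :: "'m::finite \<Rightarrow> 'a::complex_hilbert" and W :: "'a set"
  assumes basis: "orthonormal_basis_of w W"
begin

lemma onb_csubspace: "csubspace W"
  using basis unfolding orthonormal_basis_of_def by (metis complex_vector.subspace_span)

lemma onb_mem: "w i \<in> W"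
  using basis unfolding orthonormal_basis_of_def by (metis complex_vector.span_base rangeI)

lemma onb_orthonormal: "orthonormal_on UNIV w"
  using basis by (simp add: orthonormal_basis_of_def)

lemma onb_norm: "norm (w i) = 1"
  by (simp add: norm_eq_sqrt_cinner orthonormal_onD[OF onb_orthonormal])

lemma onb_expansion: "x \<in> W \<Longrightarrow> x = (\<Sum>j\<in>UNIV. cinner (w j) x *\<^sub>C w j)"
  using basis orthonormal_expansion[of UNIV w x] by (simp add: orthonormal_basis_of_def)

lemma onb_sum_mem: "(\<Sum>j\<in>UNIV. a j *\<^sub>C w j) \<in> W"
  by (intro complex_vector.subspace_sum complex_vector.subspace_scale onb_csubspace onb_mem)

lemma orth_proj_expansion: "orth_proj W x = (\<Sum>j\<in>UNIV. cinner (w j) x *\<^sub>C w j)"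
  and cinner_orth_proj_right: "y \<in> W \<Longrightarrow> cinner y (orth_proj W x) = cinner y x"
proof -
  let ?p = "\<Sum>j\<in>UNIV. cinner (w j) x *\<^sub>C w j"
  have pairing: "cinner y ?p = cinner y x" if "y \<in> W" for y
  proof -
    have "cinner y ?p = (\<Sum>j\<in>UNIV. cinner y (w j) * cinner (w j) x)"
      by (simp add: cinner_sum_right cinner_scaleC_right mult.commute)
    also have "\<dots> = cinner (\<Sum>j\<in>UNIV. cinner (w j) y *\<^sub>C w j) x"
      by (simp add: cinner_sum_left cinner_scaleC_left)
    also have "\<dots> = cinner y x"
      using onb_expansion[OF that] by simp
    finally show ?thesis .
  qed
  show eq: "orth_proj W x = ?p"
    using onb_csubspace onb_sum_mem pairing by (rule orth_proj_eqI)
  show "cinner y (orth_proj W x) = cinner y x" if "y \<in> W"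
    using pairing[OF that] by (simp add: eq)
qed

lemma orth_proj_mem: "orth_proj W x \<in> W"
  by (simp add: orth_proj_expansion onb_sum_mem)

lemma cinner_orth_proj_left: "y \<in> W \<Longrightarrow> cinner (orth_proj W x) y = cinner x y"
  by (metis cnj_cinner cinner_orth_proj_right)

lemma orth_proj_same: "x \<in> W \<Longrightarrow> orth_proj W x = x"
  by (rule orth_proj_eqI[OF onb_csubspace]) auto

lemma orth_proj_add: "orth_proj W (x + y) = orth_proj W x + orth_proj W y"
  by (simp add: orth_proj_expansion cinner_add_right scaleC_add_left sum.distrib)

lemma orth_proj_scaleC: "orth_proj W (a *\<^sub>C x) = a *\<^sub>C orth_proj W x"
  by (simp add: orth_proj_expansion cinner_scaleC_right scaleC_scaleC complex_vector.scale_sum_right)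

lemma orth_proj_zero: "orth_proj W 0 = 0"
  using orth_proj_scaleC[of 0 0] by simp

lemma orth_proj_sum: "orth_proj W (\<Sum>i\<in>A. f i) = (\<Sum>i\<in>A. orth_proj W (f i))"
  by (simp add: orth_proj_expansion cinner_sum_right complex_vector.scale_sum_left
      sum.swap[of _ _ A])

lemma norm_orth_proj_square: "complex_of_real ((norm (orth_proj W x))\<^sup>2) = cinner x (orth_proj W x)"
  by (metis cinner_same cinner_orth_proj_left orth_proj_mem)

lemma norm_orth_proj_le: "norm (orth_proj W x) \<le> norm x"
proof -
  have "cinner (orth_proj W x) (x - orth_proj W x) = 0"
    using orth_proj_mem cinner_orth_proj_right by (simp add: cinner_diff_right)
  from norm_le_norm_add_of_orthogonal[OF this] show ?thesis
    by simp
qed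

end

section \<open>The contraction ratio of a projection\<close>

text \<open>Multiplicative form of the constancy of the quotient of norms, which also covers \<open>x = 0\<close>.
  Most arguments determine only \<open>c\<^sup>2\<close>; the sign condition then determines \<open>c\<close>.\<close>

definition projects_with_ratio :: "'a::complex_hilbert set \<Rightarrow> 'a set \<Rightarrow> real \<Rightarrow> bool" where
  "projects_with_ratio V W c \<longleftrightarrow> 0 \<le> c \<and> (\<forall>x\<in>V. norm (orth_proj W x) = c * norm x)"

text \<open>A vector of the basis witnesses that \<open>V \<noteq> {0}\<close>; on the zero subspace every \<open>c\<close> would be a ratio.\<close>

lemma projects_with_ratio_unique:
  assumes "orthonormal_basis_of v V" "projects_with_ratio V W c" "projects_with_ratio V W d"
  shows "c = d"
  using assms onb_mem[OF assms(1)] onb_norm[OF assms(1)]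
  unfolding projects_with_ratio_def by (metis mult.right_neutral)

lemma ex_projects_with_ratio_iff:
  assumes "orthonormal_basis_of v V" and w: "orthonormal_basis_of w W"
  shows "(\<exists>c. \<forall>x\<in>V. x \<noteq> 0 \<longrightarrow> norm (orth_proj W x) * inverse (norm x) = c) \<longleftrightarrow>
    (\<exists>c. projects_with_ratio V W c)"
proof
  assume "\<exists>c. \<forall>x\<in>V. x \<noteq> 0 \<longrightarrow> norm (orth_proj W x) * inverse (norm x) = c"
  then obtain c where c: "\<And>x. x \<in> V \<Longrightarrow> x \<noteq> 0 \<Longrightarrow> norm (orth_proj W x) * inverse (norm x) = c"
    by blast
  have "0 \<le> c"
    using c[OF onb_mem[OF assms(1), of undefined]] onb_norm[OF assms(1), of undefined]
    by (metis inverse_1 mult.right_neutral norm_ge_zero norm_zero zero_neq_one)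
  moreover have "norm (orth_proj W x) = c * norm x" if "x \<in> V" for x
  proof (cases "x = 0")
    case True
    then show ?thesis
      using orth_proj_zero[OF w] by simp
  next
    case False
    then show ?thesis
      using c[OF that] by (simp add: field_simps)
  qed
  ultimately show "\<exists>c. projects_with_ratio V W c"
    unfolding projects_with_ratio_def by blast
next
  assume "\<exists>c. projects_with_ratio V W c"
  then show "\<exists>c. \<forall>x\<in>V. x \<noteq> 0 \<longrightarrow> norm (orth_proj W x) * inverse (norm x) = c"
    unfolding projects_with_ratio_def by (auto simp: field_simps)
qed

lemma cinner_orth_proj_of_ratio:
  assumes "orthonormal_basis_of w W" "csubspace V" "projects_with_ratio V W c" "x \<in> V" "y \<in> V"
  shows "cinner (orth_proj W x) (orth_proj W y) = complex_of_real (c\<^sup>2) * cinner x y"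
  using assms(2) _ assms(4,5)
  by (rule cinner_of_scaled_norm[OF orth_proj_add[OF assms(1)] orth_proj_scaleC[OF assms(1)]])
    (use assms(3) in \<open>simp add: projects_with_ratio_def\<close>)

text \<open>A linear map that sends an orthonormal basis to orthogonal vectors of common length \<open>c\<close>
  multiplies all norms by \<open>c\<close>, by Pythagoras. The index set \<open>S\<close> is arbitrary because the basis may
  be given as a family over a type or as an initial segment of a sequence.\<close>

lemma projects_with_ratio_of_orthogonal_images:
  assumes w: "orthonormal_basis_of w W"
    and S: "finite S" "orthonormal_on S e" "cspan (e ` S) = V" and c: "0 \<le> c"
    and im: "\<And>i j. i \<in> S \<Longrightarrow> j \<in> S \<Longrightarrow>
      cinner (orth_proj W (e i)) (orth_proj W (e j)) = (if i = j then complex_of_real (c\<^sup>2) else 0)"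
  shows "projects_with_ratio V W c"
  unfolding projects_with_ratio_def
proof (intro conjI ballI c)
  fix x assume "x \<in> V"
  define a where "a k = cinner (e k) x" for k
  have x: "x = (\<Sum>k\<in>S. a k *\<^sub>C e k)"
    using orthonormal_expansion[OF S(1,2)] \<open>x \<in> V\<close> S(3) unfolding a_def by blast
  have "complex_of_real ((norm (orth_proj W x))\<^sup>2)
      = (\<Sum>i\<in>S. \<Sum>j\<in>S. cnj (a i) * (a j * cinner (orth_proj W (e i)) (orth_proj W (e j))))"
    unfolding cinner_same[symmetric]
    by (subst (1 2) x, subst sum.swap) (simp add: orth_proj_sum[OF w] orth_proj_scaleC[OF w]
        cinner_sum_left cinner_sum_right cinner_scaleC_left cinner_scaleC_right
        sum_distrib_left mult.left_commute)
  also have "\<dots> = (\<Sum>i\<in>S. \<Sum>j\<in>S. if i = j then cnj (a i) * (a i * complex_of_real (c\<^sup>2)) else 0)"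
    by (intro sum.cong refl) (simp add: im)
  also have "\<dots> = complex_of_real (c\<^sup>2 * (\<Sum>i\<in>S. (cmod (a i))\<^sup>2))"
    unfolding of_real_mult of_real_sum complex_norm_square
    using S(1) by (simp add: sum_distrib_left mult_ac)
  also have "\<dots> = complex_of_real ((c * norm x)\<^sup>2)"
    using norm_orthonormal_combination[OF S(1,2), of a] x by (simp add: power_mult_distrib)
  finally have "(norm (orth_proj W x))\<^sup>2 = (c * norm x)\<^sup>2"
    using of_real_eq_iff by blast
  then show "norm (orth_proj W x) = c * norm x"
    using c by (simp add: power2_eq_iff_nonneg)
qed

text \<open>Both sides compute the compression of \<open>P\<^sub>W\<close> to \<open>V\<close>: forwards,
  \<open>\<parallel>P\<^sub>W x\<parallel>\<^sup>2 = \<langle>x, P\<^sub>V P\<^sub>W x\<rangle> = \<mu> \<parallel>x\<parallel>\<^sup>2\<close>; backwards, polarization gives \<open>\<langle>z, P\<^sub>W y\<rangle> = \<mu> \<langle>z, y\<rangle>\<close> for all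
  \<open>z \<in> V\<close>, which characterises \<open>\<mu> y\<close> as the projection of \<open>P\<^sub>W y\<close> onto \<open>V\<close>.\<close>

lemma proj_triple_eq_iff_ratio:
  assumes v: "orthonormal_basis_of v V" and w: "orthonormal_basis_of w W" and \<mu>: "0 \<le> \<mu>"
  shows "orth_proj V \<circ> orth_proj W \<circ> orth_proj V = (\<lambda>x. \<mu> *\<^sub>R orth_proj V x) \<longleftrightarrow>
    projects_with_ratio V W (sqrt \<mu>)"
proof
  assume eq: "orth_proj V \<circ> orth_proj W \<circ> orth_proj V = (\<lambda>x. \<mu> *\<^sub>R orth_proj V x)"
  show "projects_with_ratio V W (sqrt \<mu>)"
    unfolding projects_with_ratio_def
  proof (intro conjI ballI)
    fix x assume x: "x \<in> V"
    have "orth_proj V (orth_proj W x) = \<mu> *\<^sub>R x"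
      using fun_cong[OF eq, of x] by (simp add: orth_proj_same[OF v x])
    then have "complex_of_real ((norm (orth_proj W x))\<^sup>2) = cinner x (\<mu> *\<^sub>R x)"
      by (metis norm_orth_proj_square[OF w] cinner_orth_proj_right[OF v x])
    also have "\<dots> = complex_of_real (\<mu> * (norm x)\<^sup>2)"
      by (simp add: scaleR_scaleC cinner_scaleC_right cinner_same)
    finally have "(norm (orth_proj W x))\<^sup>2 = \<mu> * (norm x)\<^sup>2"
      using of_real_eq_iff by blast
    then show "norm (orth_proj W x) = sqrt \<mu> * norm x"
      by (metis norm_ge_zero real_sqrt_mult real_sqrt_unique real_sqrt_abs abs_norm_cancel)
  qed (use \<mu> in simp)
next
  assume r: "projects_with_ratio V W (sqrt \<mu>)"
  have "orth_proj V (orth_proj W y) = \<mu> *\<^sub>R y" if y: "y \<in> V" for y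
  proof (rule orth_proj_eqI[OF onb_csubspace[OF v]])
    show "\<mu> *\<^sub>R y \<in> V"
      unfolding scaleR_scaleC using onb_csubspace[OF v] y by (rule complex_vector.subspace_scale)
    show "cinner z (\<mu> *\<^sub>R y) = cinner z (orth_proj W y)" if "z \<in> V" for z
      using cinner_orth_proj_of_ratio[OF w onb_csubspace[OF v] r that y] \<mu>
      by (simp add: scaleR_scaleC cinner_scaleC_right cinner_orth_proj_left[OF w orth_proj_mem[OF w]])
  qed
  then show "orth_proj V \<circ> orth_proj W \<circ> orth_proj V = (\<lambda>x. \<mu> *\<^sub>R orth_proj V x)"
    using orth_proj_mem[OF v] by (auto simp: fun_eq_iff)
qed

section \<open>The matrix of inner products\<close>

text \<open>The rows of \<open>M\<close> are, up to conjugation, the coordinates of the vectors \<open>P\<^sub>W v\<^sub>i\<close> in the basis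
  \<open>w\<close>, so \<open>M M\<^sup>*\<close> is their Gram matrix.\<close>

lemma mult_conj_transpose_cross_gram:
  fixes v w :: "'m::finite \<Rightarrow> 'a::complex_hilbert"
  assumes "orthonormal_basis_of w W"
  defines "M \<equiv> \<chi> i j. cinner (v i) (w j)"
  shows "(M ** conj_transpose M) $ i $ k = cinner (orth_proj W (v i)) (orth_proj W (v k))"
proof -
  have "cinner (orth_proj W (v i)) (orth_proj W (v k)) = cinner (v i) (orth_proj W (v k))"
    using cinner_orth_proj_left orth_proj_mem assms(1) by metis
  then show ?thesis
    by (simp add: M_def matrix_matrix_mult_def conj_transpose_def orth_proj_expansion[OF assms(1)]
        cinner_sum_right cinner_scaleC_right mult.commute)
qed

text \<open>Since \<open>M\<close> is square, the one-sided identity \<open>M M\<^sup>* = c\<^sup>2 1\<close> suffices for \<open>M / c\<close> to be unitary.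
  When \<open>c = 0\<close> the subspaces are orthogonal, \<open>M\<close> vanishes, and any unitary will do.\<close>

lemma cross_gram_scaled_unitary_iff_ratio:
  fixes v w :: "'m::finite \<Rightarrow> 'a::complex_hilbert"
  assumes v: "orthonormal_basis_of v V" and w: "orthonormal_basis_of w W"
  shows "(\<exists>c U. unitary_matrix U \<and> (\<chi> i j. cinner (v i) (w j)) = (\<chi> i j. c * U $ i $ j)) \<longleftrightarrow>
    (\<exists>c. projects_with_ratio V W c)"
proof
  let ?M = "\<chi> i j. cinner (v i) (w j)"
  assume "\<exists>c U. unitary_matrix U \<and> ?M = (\<chi> i j. c * U $ i $ j)"
  then obtain c U where U: "U ** conj_transpose U = mat 1" and M: "?M = (\<chi> i j. c * U $ i $ j)"
    unfolding unitary_matrix_def by blast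
  have "cinner (orth_proj W (v i)) (orth_proj W (v k))
      = (if i = k then complex_of_real ((cmod c)\<^sup>2) else 0)" for i k
  proof -
    have "cinner (orth_proj W (v i)) (orth_proj W (v k)) = (?M ** conj_transpose ?M) $ i $ k"
      by (simp add: mult_conj_transpose_cross_gram[OF w])
    also have "\<dots> = c * cnj c * (U ** conj_transpose U) $ i $ k"
      unfolding M by (simp add: matrix_matrix_mult_def conj_transpose_def sum_distrib_left mult_ac)
    finally show ?thesis
      unfolding U complex_norm_square by (simp add: mat_def)
  qed
  then have "projects_with_ratio V W (cmod c)"
    using v by (intro projects_with_ratio_of_orthogonal_images[OF w, of UNIV v])
      (auto simp: orthonormal_basis_of_def)
  then show "\<exists>c. projects_with_ratio V W c" ..
next
  let ?M = "\<chi> i j. cinner (v i) (w j)"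
  assume "\<exists>c. projects_with_ratio V W c"
  then obtain c where c: "projects_with_ratio V W c" ..
  have gram: "(?M ** conj_transpose ?M) $ i $ k = (if i = k then complex_of_real (c\<^sup>2) else 0)" for i k
    unfolding mult_conj_transpose_cross_gram[OF w]
      cinner_orth_proj_of_ratio[OF w onb_csubspace[OF v] c onb_mem[OF v] onb_mem[OF v]]
    using orthonormal_onD[OF onb_orthonormal[OF v]] by simp
  show "\<exists>c U. unitary_matrix U \<and> ?M = (\<chi> i j. c * U $ i $ j)"
  proof (cases "c = 0")
    case True
    then have "orth_proj W (v i) = 0" for i
      using c onb_mem[OF v, of i] by (simp add: projects_with_ratio_def)
    then have "cinner (v i) (w j) = 0" for i j
      using cinner_orth_proj_left[OF w onb_mem[OF w], of "v i" j] by simp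
    then have "?M = (\<chi> i j. 0 * (mat 1 :: complex^'m^'m) $ i $ j)"
      by (simp add: vec_eq_iff)
    moreover have "conj_transpose (mat 1 :: complex^'m^'m) = mat 1"
      by (auto simp: conj_transpose_def mat_def vec_eq_iff)
    then have "unitary_matrix (mat 1 :: complex^'m^'m)"
      by (simp add: unitary_matrix_def)
    ultimately show ?thesis
      by blast
  next
    case False
    define U where "U = (\<chi> i j. ?M $ i $ j / complex_of_real c)"
    have "(U ** conj_transpose U) $ i $ k = (?M ** conj_transpose ?M) $ i $ k / complex_of_real (c\<^sup>2)" for i k
      by (simp add: U_def matrix_matrix_mult_def conj_transpose_def sum_divide_distrib power2_eq_square)
    then have "U ** conj_transpose U = mat 1"
      using False unfolding gram by (simp add: vec_eq_iff mat_def)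
    then have "unitary_matrix U"
      by (simp add: unitary_matrix_def matrix_left_right_inverse)
    moreover have "?M = (\<chi> i j. complex_of_real c * U $ i $ j)"
      using False by (simp add: U_def vec_eq_iff)
    ultimately show ?thesis
      by blast
  qed
qed

section \<open>Canonical angles\<close>

lemma cmod_cinner_commute: "cmod (cinner x y) = cmod (cinner y x)"
  by (metis cnj_cinner complex_mod_cnj)

lemma isoclinic_at_sym:
  assumes "isoclinic_at V W t"
  shows "isoclinic_at W V t"
proof -
  obtain \<theta> x y where \<theta>: "\<forall>k < min (cdim V) (cdim W).
        0 \<le> \<theta> k \<and> \<theta> k \<le> pi / 2 \<and>
        (x k, y k) \<in> admissible_pairs V W x y k \<and>
        cmod (cinner (x k) (y k)) = cos (\<theta> k) \<and>
        (\<forall>(u, w) \<in> admissible_pairs V W x y k. cmod (cinner u w) \<le> cos (\<theta> k))"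
      "\<forall>k < min (cdim V) (cdim W). \<theta> k = t"
    using assms unfolding isoclinic_at_def canonical_angles_def by blast
  have swap: "(u, w) \<in> admissible_pairs W V y x k \<longleftrightarrow> (w, u) \<in> admissible_pairs V W x y k" for u w k
    by (auto simp: admissible_pairs_def)
  have bound: "cmod (cinner u w) \<le> cos (\<theta> k)"
    if "k < min (cdim V) (cdim W)" "(w, u) \<in> admissible_pairs V W x y k" for k u w
    using \<theta>(1) that cmod_cinner_commute[of u w] by fastforce
  have "canonical_angles W V \<theta>"
    unfolding canonical_angles_def
    by (rule exI[of _ y], rule exI[of _ x])
      (use \<theta>(1) bound in \<open>auto simp: swap min.commute cmod_cinner_commute[of "y _"]\<close>)
  then show ?thesis
    using \<theta>(2) unfolding isoclinic_at_def by (auto simp: min.commute)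
qed

lemma orthonormal_on_nat:
  fixes x :: "nat \<Rightarrow> 'a::complex_hilbert"
  assumes "\<And>k. k < n \<Longrightarrow> norm (x k) = 1" "\<And>j k. j < k \<Longrightarrow> k < n \<Longrightarrow> cinner (x j) (x k) = 0"
  shows "orthonormal_on {..<n} x"
  unfolding orthonormal_on_def
proof (intro ballI)
  fix i j assume "i \<in> {..<n}" "j \<in> {..<n}"
  then show "cinner (x i) (x j) = (if i = j then 1 else 0)"
    using assms(1)[of i] assms(2)[of i j] assms(2)[of j i] cinner_same[of "x i"] cnj_cinner[of "x j" "x i"]
    by (cases i j rule: linorder_cases) auto
qed

text \<open>Only the first maximum has no orthogonality constraint, and it alone bounds the norm of \<open>P\<^sub>W\<close> on
  \<open>V\<close> by \<open>cos t\<close>. The later maxima enter through being attained: \<open>P\<^sub>W x\<^sub>k\<close> has a component of length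
  \<open>cos t\<close> along \<open>y\<^sub>k\<close>, which leaves no room for another component.\<close>

lemma isoclinic_at_imp_ratio:
  fixes w :: "'m::finite \<Rightarrow> 'a::complex_hilbert"
  assumes w: "orthonormal_basis_of w W" and V: "csubspace V"
    and dim: "cdim V = CARD('m)" "cdim W = CARD('m)"
    and iso: "isoclinic_at V W t"
  shows "projects_with_ratio V W (cos t)"
proof -
  define n where "n = CARD('m)"
  have n: "0 < n"
    by (simp add: n_def)
  obtain x y where xy: "\<And>k. k < n \<Longrightarrow> (x k, y k) \<in> admissible_pairs V W x y k"
    and max: "\<And>k. k < n \<Longrightarrow> cmod (cinner (x k) (y k)) = cos t"
      "\<And>k u w. k < n \<Longrightarrow> (u, w) \<in> admissible_pairs V W x y k \<Longrightarrow> cmod (cinner u w) \<le> cos t"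
    using iso unfolding isoclinic_at_def canonical_angles_def dim n_def by fastforce
  have cos: "0 \<le> cos t"
    using max(1)[OF n] by (metis norm_ge_zero)
  have on: "orthonormal_on {..<n} x" "orthonormal_on {..<n} y"
    using xy by (auto intro!: orthonormal_on_nat simp: admissible_pairs_def)
  have mem: "x k \<in> V" "y k \<in> W" "norm (x k) = 1" "norm (y k) = 1" if "k < n" for k
    using xy[OF that] by (auto simp: admissible_pairs_def)
  have bound: "norm (orth_proj W u) \<le> cos t" if "u \<in> V" "norm u = 1" for u
  proof (cases "orth_proj W u = 0")
    case False
    \<comment> \<open>The unit vector of \<open>W\<close> closest in direction to \<open>u\<close>; its inner product with \<open>u\<close> is \<open>\<parallel>P\<^sub>W u\<parallel>\<close>.\<close>
    define z where "z = complex_of_real (inverse (norm (orth_proj W u))) *\<^sub>C orth_proj W u"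
    have "z \<in> W"
      unfolding z_def using onb_csubspace[OF w] orth_proj_mem[OF w]
      by (rule complex_vector.subspace_scale)
    moreover have "norm z = 1"
      using False by (simp add: z_def norm_scaleC norm_inverse)
    ultimately have "cmod (cinner u z) \<le> cos t"
      using max(2)[OF n] that by (simp add: admissible_pairs_def)
    moreover have "cinner u z = complex_of_real (norm (orth_proj W u))"
      using False unfolding z_def cinner_scaleC_right norm_orth_proj_square[OF w, symmetric]
      by (simp add: power2_eq_square)
    ultimately show ?thesis
      by simp
  qed (use cos in simp)
  have image: "orth_proj W (x k) = cinner (y k) (x k) *\<^sub>C y k" if k: "k < n" for k
  proof -
    define \<alpha> where "\<alpha> = cinner (y k) (x k)"
    \<comment> \<open>The part of \<open>P\<^sub>W x\<^sub>k\<close> orthogonal to \<open>y\<^sub>k\<close>, to be shown zero.\<close>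
    define d where "d = orth_proj W (x k) - \<alpha> *\<^sub>C y k"
    have "cmod \<alpha> = cos t"
      using max(1)[OF k] by (simp add: \<alpha>_def cmod_cinner_commute[of "y k"])
    moreover have "cinner (\<alpha> *\<^sub>C y k) d = 0"
      using mem[OF k] by (simp add: d_def \<alpha>_def cinner_diff_right cinner_scaleC_left
          cinner_scaleC_right cinner_orth_proj_right[OF w] cinner_same[of "y k"])
    ultimately have "(norm (orth_proj W (x k)))\<^sup>2 = (cos t)\<^sup>2 + (norm d)\<^sup>2"
      using norm_add_square[of "\<alpha> *\<^sub>C y k" d] mem[OF k] by (simp add: norm_scaleC d_def)
    moreover have "(norm (orth_proj W (x k)))\<^sup>2 \<le> (cos t)\<^sup>2"
      using bound[OF mem(1,3)[OF k]] by (simp add: power_mono)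
    ultimately have "d = 0"
      by simp
    then show ?thesis
      by (simp add: d_def \<alpha>_def)
  qed
  show ?thesis
  proof (rule projects_with_ratio_of_orthogonal_images[OF w _ on(1) _ cos])
    show "cspan (x ` {..<n}) = V"
      using on(1) _ V by (rule orthonormal_spans_of_card) (use mem n dim in \<open>auto simp: n_def\<close>)
    fix i j assume ij: "i \<in> {..<n}" "j \<in> {..<n}"
    have "cnj (cinner (y i) (x i)) * cinner (y i) (x i) = complex_of_real ((cos t)\<^sup>2)"
      using max(1)[of i] ij complex_norm_square[of "cinner (x i) (y i)"] by simp
    then show "cinner (orth_proj W (x i)) (orth_proj W (x j))
        = (if i = j then complex_of_real ((cos t)\<^sup>2) else 0)"
      using ij orthonormal_onD[OF on(2) ij]
      by (auto simp: image cinner_scaleC_left cinner_scaleC_right mult.commute)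
  qed simp
qed

text \<open>With ratio \<open>c\<close> no pair of unit vectors has an inner product larger than \<open>c\<close> in modulus, and
  each basis vector \<open>v\<^sub>i\<close> attains \<open>c\<close> with the normalised \<open>P\<^sub>W v\<^sub>i\<close>, if \<open>c > 0\<close>. These partners are again
  orthonormal, so the constraints of the recursion are met in any order of the basis.\<close>

lemma ratio_imp_isoclinic_at:
  fixes v w :: "'m::finite \<Rightarrow> 'a::complex_hilbert"
  assumes v: "orthonormal_basis_of v V" and w: "orthonormal_basis_of w W"
    and dim: "cdim V = CARD('m)" "cdim W = CARD('m)"
    and c: "projects_with_ratio V W c"
  shows "isoclinic_at V W (arccos c)"
proof -
  have c0: "0 \<le> c" and cV: "\<And>x. x \<in> V \<Longrightarrow> norm (orth_proj W x) = c * norm x"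
    using c by (auto simp: projects_with_ratio_def)
  have c1: "c \<le> 1"
    using cV[OF onb_mem[OF v]] norm_orth_proj_le[OF w, of "v undefined"] by (simp add: onb_norm[OF v])
  \<comment> \<open>For \<open>c = 0\<close> the images vanish and any orthonormal family in \<open>W\<close> serves as partners.\<close>
  define u where "u i = (if c = 0 then w i else complex_of_real (inverse c) *\<^sub>C orth_proj W (v i))" for i
  have uW: "u i \<in> W" for i
    unfolding u_def
    by (simp add: onb_mem[OF w] complex_vector.subspace_scale[OF onb_csubspace[OF w] orth_proj_mem[OF w]])
  have image: "orth_proj W (v i) = complex_of_real c *\<^sub>C u i" for i
    using cV[OF onb_mem[OF v], of i]
    by (auto simp: u_def scaleC_scaleC scaleC_one)
  have on_u: "cinner (u i) (u j) = (if i = j then 1 else 0)" for i j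
  proof (cases "c = 0")
    case True
    then show ?thesis
      using orthonormal_onD[OF onb_orthonormal[OF w]] by (simp add: u_def)
  next
    case False
    then show ?thesis
      using cinner_orth_proj_of_ratio[OF w onb_csubspace[OF v] c onb_mem[OF v] onb_mem[OF v], of i j]
        orthonormal_onD[OF onb_orthonormal[OF v], of i j]
      by (simp add: u_def cinner_scaleC_left cinner_scaleC_right power2_eq_square field_simps)
  qed
  have pair: "cinner (v i) (u i) = complex_of_real c" for i
    using cinner_orth_proj_left[OF w uW, of "v i" i] on_u[of i i]
    by (simp add: image cinner_scaleC_left)
  have norm_u: "norm (u i) = 1" for i
    using on_u[of i i] by (simp add: norm_eq_sqrt_cinner)
  obtain f where f: "bij_betw f {0..<CARD('m)} (UNIV :: 'm set)"
    using ex_bij_betw_nat_finite[of "UNIV :: 'm set"] by auto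
  have f_neq: "f j \<noteq> f k" if "j < k" "k < CARD('m)" for j k
    using f that unfolding bij_betw_def inj_on_def by fastforce
  have "canonical_angles V W (\<lambda>_. arccos c)"
    unfolding canonical_angles_def dim
  proof (rule exI[of _ "v \<circ> f"], rule exI[of _ "u \<circ> f"], intro allI impI conjI)
    fix k assume k: "k < min CARD('m) CARD('m)"
    show "0 \<le> arccos c" "arccos c \<le> pi / 2"
      using c0 c1 arccos_lbound arccos_le_pi2 by auto
    show "((v \<circ> f) k, (u \<circ> f) k) \<in> admissible_pairs V W (v \<circ> f) (u \<circ> f) k"
      using f_neq k orthonormal_onD[OF onb_orthonormal[OF v]]
      by (auto simp: admissible_pairs_def onb_mem[OF v] uW onb_norm[OF v] norm_u on_u)
    show "cmod (cinner ((v \<circ> f) k) ((u \<circ> f) k)) = cos (arccos c)"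
      using c0 c1 by (simp add: pair)
    have "cmod (cinner a b) \<le> c" if "a \<in> V" "b \<in> W" "norm a = 1" "norm b = 1" for a b
      using Cauchy_Schwarz[of "orth_proj W a" b] cV[OF that(1)] that
      by (simp add: cinner_orth_proj_left[OF w that(2)])
    then show "\<forall>(a, b)\<in>admissible_pairs V W (v \<circ> f) (u \<circ> f) k. cmod (cinner a b) \<le> cos (arccos c)"
      using c0 c1 by (auto simp: admissible_pairs_def)
  qed
  then show ?thesis
    unfolding isoclinic_at_def by blast
qed

theorem theorem4:
  fixes V W :: "'a::complex_hilbert set"
    and v w :: "'m::finite \<Rightarrow> 'a"
    and I :: "'i set" and e :: "'i \<Rightarrow> 'a"
  assumes "csubspace V" and "csubspace W"
    and "cdim V = CARD('m)" and "cdim W = CARD('m)"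
    and "orthonormal_basis_of v V" and "orthonormal_basis_of w W"
    and "hilbert_basis I e"
  shows "(isoclinic V W \<longleftrightarrow>
           (\<exists>c U. unitary_matrix U \<and>
              adjoint_times I (coord_matrix e v) (coord_matrix e w) = (\<chi> i j. c * U $ i $ j)))
       \<and> (isoclinic V W \<longleftrightarrow>
           (\<exists>\<mu>::real. \<mu> \<ge> 0 \<and>
              orth_proj V \<circ> orth_proj W \<circ> orth_proj V = (\<lambda>x. \<mu> *\<^sub>R orth_proj V x) \<and>
              orth_proj W \<circ> orth_proj V \<circ> orth_proj W = (\<lambda>x. \<mu> *\<^sub>R orth_proj W x)))
       \<and> (\<forall>(\<mu>::real) \<theta>. \<mu> \<ge> 0 \<and>
              orth_proj V \<circ> orth_proj W \<circ> orth_proj V = (\<lambda>x. \<mu> *\<^sub>R orth_proj V x) \<and>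
              orth_proj W \<circ> orth_proj V \<circ> orth_proj W = (\<lambda>x. \<mu> *\<^sub>R orth_proj W x) \<and>
              isoclinic_at V W \<theta> \<longrightarrow> \<mu> = (cos \<theta>)\<^sup>2)
       \<and> (isoclinic V W \<longleftrightarrow>
           (\<exists>c::real. \<forall>x\<in>V. x \<noteq> 0 \<longrightarrow> norm (orth_proj W x) * inverse (norm x) = c) \<and>
           (\<exists>c::real. \<forall>x\<in>W. x \<noteq> 0 \<longrightarrow> norm (orth_proj V x) * inverse (norm x) = c))"
proof -
  note v = assms(5) and w = assms(6)
  have ratio: "projects_with_ratio V W (cos t)" "projects_with_ratio W V (cos t)"
    if "isoclinic_at V W t" for t
    using isoclinic_at_imp_ratio[OF w assms(1) assms(3,4) that]
      isoclinic_at_imp_ratio[OF v assms(2) assms(4,3) isoclinic_at_sym[OF that]] by auto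
  have iso_iff: "isoclinic V W \<longleftrightarrow> (\<exists>c. projects_with_ratio V W c)"
    using ratio(1) ratio_imp_isoclinic_at[OF v w assms(3,4)] unfolding isoclinic_def by blast
  note triple_VW = proj_triple_eq_iff_ratio[OF v w] and triple_WV = proj_triple_eq_iff_ratio[OF w v]
  show ?thesis
  proof (intro conjI allI impI)
    show "isoclinic V W \<longleftrightarrow> (\<exists>c U. unitary_matrix U \<and>
        adjoint_times I (coord_matrix e v) (coord_matrix e w) = (\<chi> i j. c * U $ i $ j))"
      unfolding iso_iff adjoint_times_coord_matrix[OF assms(7)]
      by (rule cross_gram_scaled_unitary_iff_ratio[OF v w, symmetric])
  next
    show "isoclinic V W \<longleftrightarrow> (\<exists>\<mu>::real. \<mu> \<ge> 0 \<and>
        orth_proj V \<circ> orth_proj W \<circ> orth_proj V = (\<lambda>x. \<mu> *\<^sub>R orth_proj V x) \<and>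
        orth_proj W \<circ> orth_proj V \<circ> orth_proj W = (\<lambda>x. \<mu> *\<^sub>R orth_proj W x))"
      (is "_ \<longleftrightarrow> ?triples")
    proof
      assume "isoclinic V W"
      then obtain t where t: "isoclinic_at V W t"
        unfolding isoclinic_def ..
      have "0 \<le> cos t"
        using ratio(1)[OF t] by (simp add: projects_with_ratio_def)
      then have "sqrt ((cos t)\<^sup>2) = cos t"
        by simp
      then show ?triples
        using ratio[OF t] triple_VW[of "(cos t)\<^sup>2"] triple_WV[of "(cos t)\<^sup>2"]
        by (intro exI[of _ "(cos t)\<^sup>2"]) simp
    next
      assume ?triples
      then show "isoclinic V W"
        using triple_VW iso_iff by blast
    qed
  next
    fix \<mu> t :: real
    assume a: "\<mu> \<ge> 0 \<and>
        orth_proj V \<circ> orth_proj W \<circ> orth_proj V = (\<lambda>x. \<mu> *\<^sub>R orth_proj V x) \<and>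
        orth_proj W \<circ> orth_proj V \<circ> orth_proj W = (\<lambda>x. \<mu> *\<^sub>R orth_proj W x) \<and>
        isoclinic_at V W t"
    then have "projects_with_ratio V W (sqrt \<mu>)"
      using triple_VW by blast
    then have "sqrt \<mu> = cos t"
      using projects_with_ratio_unique[OF v] ratio(1) a by blast
    then show "\<mu> = (cos t)\<^sup>2"
      using a by (metis real_sqrt_pow2)
  next
    show "isoclinic V W \<longleftrightarrow>
        (\<exists>c::real. \<forall>x\<in>V. x \<noteq> 0 \<longrightarrow> norm (orth_proj W x) * inverse (norm x) = c) \<and>
        (\<exists>c::real. \<forall>x\<in>W. x \<noteq> 0 \<longrightarrow> norm (orth_proj V x) * inverse (norm x) = c)"
      unfolding ex_projects_with_ratio_iff[OF v w] ex_projects_with_ratio_iff[OF w v]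
      using iso_iff ratio(2) unfolding isoclinic_def by blast
  qed
qed

end
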